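(* Let $A\in\mathrm{GL}(n)$ and $\Sigma_0\in\mathrm{P}(n)$. Then there exist unique matrices $P\in\mathrm{P}(n)$ and $Q\in\mathrm{O}(n,\Sigma_0)$ such that $$A=PQ.$$ Moreover, with $\Sigma_1 = A\Sigma_0A^\top$, the matrix $P$ is the unique solution of the following problem: among all $B\in\mathrm{GL}(n)$ satisfying $B\Sigma_0B^\top=\Sigma_1$, minimize $$J(B)=\operatorname{tr}\big((I-B)\Sigma_0(I-B)^\top\big).$$
   Context: All matrices are real $n\times n$. $\mathrm{GL}(n)$ is the group of invertible matrices, $I$ the identity matrix, and $\mathrm{P}(n)$ the set of symmetric positive definite matrices. For $\Sigma_0\in\mathrm{P}(n)$, $\mathrm{O}(n,\Sigma_0)=\{Q\in\mathrm{GL}(n)\mid Q\Sigma_0Q^\top=\Sigma_0\}$. *)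

theory Defs
  imports "HOL-Analysis.Analysis"
begin

definition GL :: "(real^'n^'n) set" where
  "GL = {A. invertible A}"

definition SPD :: "(real^'n^'n) set" where
  "SPD = {A. transpose A = A \<and> (\<forall>x. x \<noteq> 0 \<longrightarrow> 0 < x \<bullet> (A *v x))}"

text \<open>For \<open>S = mat 1\<close> this is the usual orthogonal group.\<close>

definition O_group :: "real^'n^'n \<Rightarrow> (real^'n^'n) set" where
  "O_group S = {Q \<in> GL. Q ** S ** transpose Q = S}"

definition J :: "real^'n^'n \<Rightarrow> real^'n^'n \<Rightarrow> real" where
  "J S B = trace ((mat 1 - B) ** S ** transpose (mat 1 - B))"

end

theory Submission
  imports Defs
begin

text \<open>
  A decomposition \<open>A = PQ\<close> amounts to a solution \<open>P \<in> SPD\<close> of \<open>P \<Sigma>\<^sub>0 P = \<Sigma>\<^sub>1\<close>, because then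
  \<open>Q = P\<^sup>-\<^sup>1 A\<close> lies in \<open>O_group \<Sigma>\<^sub>0\<close>.  With \<open>K = \<Sigma>\<^sub>0\<^sup>1\<^sup>/\<^sup>2\<close> such a solution is
  \<open>K\<^sup>-\<^sup>1 (K \<Sigma>\<^sub>1 K)\<^sup>1\<^sup>/\<^sup>2 K\<^sup>-\<^sup>1\<close>.
  Any feasible \<open>B\<close> has the form \<open>P Q\<close> with \<open>Q \<in> O_group \<Sigma>\<^sub>0\<close>, and then
  \<open>J B - J P = tr (P (1 - Q) \<Sigma>\<^sub>0 (1 - Q)\<^sup>T)\<close>, which is positive unless \<open>Q = 1\<close>.  So every solution
  \<open>P\<close> is the strict minimizer of \<open>J\<close>, which also shows that there is only one.

  Square roots come from Banach's fixed point theorem instead of the spectral theorem: after scaling,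
  \<open>S = 1 - X\<close> with \<open>\<parallel>X\<parallel> < 1\<close>, and \<open>1 - Y\<close> is a square root of \<open>S\<close> when \<open>Y = (X + Y\<^sup>2) / 2\<close>.
\<close>

section \<open>Square roots of positive definite self-adjoint maps\<close>

text \<open>By compactness the quadratic form attains a positive minimum on the unit sphere;
  homogeneity of degree two extends the bound to all vectors.\<close>

lemma posdef_linear_coercive:
  fixes f :: "'a::euclidean_space \<Rightarrow> 'a"
  assumes "linear f" and pos: "\<And>x. x \<noteq> 0 \<Longrightarrow> 0 < x \<bullet> f x"
  obtains m where "m > 0" "\<And>x. m * (norm x)\<^sup>2 \<le> x \<bullet> f x"
proof -
  have cont: "continuous_on (sphere 0 1) (\<lambda>x. x \<bullet> f x)"
    using assms(1) by (intro continuous_intros linear_continuous_on linear_conv_bounded_linear[THEN iffD1])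
  have "sphere (0::'a) 1 \<noteq> {}" by simp
  then obtain u where u: "u \<in> sphere 0 1" "\<And>y. y \<in> sphere 0 1 \<Longrightarrow> u \<bullet> f u \<le> y \<bullet> f y"
    using continuous_attains_inf[OF compact_sphere _ cont] by blast
  have "u \<noteq> 0" using u(1) by auto
  moreover have "(u \<bullet> f u) * (norm x)\<^sup>2 \<le> x \<bullet> f x" for x
  proof (cases "x = 0")
    case False
    have "u \<bullet> f u \<le> (x /\<^sub>R norm x) \<bullet> f (x /\<^sub>R norm x)"
      using False by (intro u) simp
    also have "\<dots> = (x \<bullet> f x) / (norm x)\<^sup>2"
      by (simp add: linear_cmul[OF assms(1)] power2_eq_square divide_inverse)
    finally show ?thesis using False by (simp add: field_simps)
  qed (simp add: linear_0[OF assms(1)])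
  ultimately show ?thesis using pos that by blast
qed

lemma sqrt_one_minus_blinfun:
  fixes X :: "'a::euclidean_space \<Rightarrow>\<^sub>L 'a"
  assumes sa: "\<And>x y. X x \<bullet> y = x \<bullet> X y" and nX: "norm X < 1"
  obtains Y where "norm Y < 1" "\<And>x y. blinfun_apply Y x \<bullet> y = x \<bullet> Y y"
    "\<And>x. (x - Y x) - Y (x - Y x) = x - X x"
proof -
  define F where "F Y = (X + (Y o\<^sub>L Y)) /\<^sub>R 2" for Y
  \<comment> \<open>Self-adjointness is a closed condition, so building it into \<open>D\<close>
    passes it on to the fixed point.\<close>
  define D where "D = cball 0 (norm X) \<inter> {Y :: 'a \<Rightarrow>\<^sub>L 'a. \<forall>x y. Y x \<bullet> y = x \<bullet> Y y}"
  have "closed {Y :: 'a \<Rightarrow>\<^sub>L 'a. \<forall>x y. Y x \<bullet> y = x \<bullet> Y y}"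
    by (intro closed_Collect_all closed_Collect_eq continuous_intros)
  then have "complete D"
    unfolding D_def complete_eq_closed by (intro closed_Int closed_cball)
  moreover have "0 \<in> D" by (simp add: D_def)
  moreover have "F Y \<in> D" if "Y \<in> D" for Y
  proof -
    have nY: "norm Y \<le> norm X" and sY: "\<And>x y. Y x \<bullet> y = x \<bullet> Y y" using that by (auto simp: D_def)
    have "norm (Y o\<^sub>L Y) \<le> norm Y * norm Y" by (rule norm_blinfun_compose)
    also have "\<dots> \<le> norm X * 1" using nY nX by (intro mult_mono) auto
    finally have "norm (X + (Y o\<^sub>L Y)) \<le> 2 * norm X"
      using norm_triangle_ineq[of X "Y o\<^sub>L Y"] by linarith
    then show ?thesis
      by (simp add: D_def F_def blinfun.bilinear_simps sa sY inner_add_left inner_add_right)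
  qed
  moreover have "dist (F Y) (F Z) \<le> norm X * dist Y Z" if "Y \<in> D" "Z \<in> D" for Y Z
  proof -
    have n: "norm Y \<le> norm X" "norm Z \<le> norm X" using that by (auto simp: D_def)
    \<comment> \<open>\<open>Y\<close> and \<open>Z\<close> need not commute, which dictates this
      splitting of the difference of squares.\<close>
    have "(Y o\<^sub>L Y) - (Z o\<^sub>L Z) = (Y o\<^sub>L (Y - Z)) + ((Y - Z) o\<^sub>L Z)"
      by (rule blinfun_eqI) (simp add: blinfun.bilinear_simps)
    also have "norm \<dots> \<le> norm Y * norm (Y - Z) + norm (Y - Z) * norm Z"
      by (intro order_trans[OF norm_triangle_ineq] add_mono norm_blinfun_compose)
    also have "\<dots> \<le> norm X * norm (Y - Z) + norm (Y - Z) * norm X"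
      using n by (intro add_mono mult_right_mono mult_left_mono) auto
    finally have "norm ((Y o\<^sub>L Y) - (Z o\<^sub>L Z)) \<le> 2 * (norm X * norm (Y - Z))" by simp
    moreover have "F Y - F Z = ((Y o\<^sub>L Y) - (Z o\<^sub>L Z)) /\<^sub>R 2"
      by (simp add: F_def scaleR_diff_right scaleR_add_right)
    ultimately show ?thesis by (simp add: dist_norm)
  qed
  ultimately obtain Y where Y: "Y \<in> D" "F Y = Y"
    using Banach_fix[of D "norm X" F] nX by (auto simp: image_subset_iff)
  have "2 *\<^sub>R Y = X + (Y o\<^sub>L Y)" using arg_cong[OF Y(2), of "\<lambda>Z. 2 *\<^sub>R Z"] by (simp add: F_def)
  then have "2 *\<^sub>R Y x = X x + Y (Y x)" for x
    by (metis blinfun.add_left blinfun.scaleR_left blinfun_apply_blinfun_compose)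
  then have "(x - Y x) - Y (x - Y x) = x - X x" for x
    by (simp add: blinfun.bilinear_simps algebra_simps scaleR_2)
  moreover have "norm Y < 1" using Y(1) nX by (auto simp: D_def)
  moreover have "Y x \<bullet> y = x \<bullet> Y y" for x y using Y(1) by (simp add: D_def)
  ultimately show ?thesis using that by blast
qed

lemma posdef_selfadjoint_sqrt:
  fixes f :: "'a::euclidean_space \<Rightarrow> 'a"
  assumes lin: "linear f" and sa: "\<And>x y. f x \<bullet> y = x \<bullet> f y"
    and pos: "\<And>x. x \<noteq> 0 \<Longrightarrow> 0 < x \<bullet> f x"
  obtains g where "linear g" "\<And>x y. g x \<bullet> y = x \<bullet> g y"
    "\<And>x. x \<noteq> 0 \<Longrightarrow> 0 < x \<bullet> g x" "\<And>x. g (g x) = f x"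
proof -
  obtain m where m: "m > 0" "\<And>x. m * (norm x)\<^sup>2 \<le> x \<bullet> f x"
    using posdef_linear_coercive[OF lin pos] by blast
  obtain M where M: "M > 0" "\<And>x. norm (f x) \<le> M * norm x"
    using linear_bounded_pos[OF lin] by blast
  define c where "c = M\<^sup>2 / m"
  have c: "c > 0" using m M by (simp add: c_def)
  define q where "q = 1 - m / c"
  define X where "X = Blinfun (\<lambda>x. x - f x /\<^sub>R c)"
  have "bounded_linear f" using lin by (simp add: linear_conv_bounded_linear)
  then have X: "blinfun_apply X x = x - f x /\<^sub>R c" for x
    unfolding X_def
    by (subst bounded_linear_Blinfun_apply) (auto intro!: bounded_linear_intros)
  \<comment> \<open>The choice of \<open>c\<close> makes the quadratic term equal to half the linear one.\<close>
  have bd: "(norm (X x))\<^sup>2 \<le> q * (norm x)\<^sup>2" for x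
  proof -
    have "(norm (X x))\<^sup>2 = (norm x)\<^sup>2 - 2 / c * (x \<bullet> f x) + (norm (f x))\<^sup>2 / c\<^sup>2"
      using c by (simp add: X power2_norm_eq_inner inner_diff inner_commute divide_simps)
        (simp add: algebra_simps power2_eq_square)
    also have "\<dots> \<le> (norm x)\<^sup>2 - 2 / c * (m * (norm x)\<^sup>2) + (M * norm x)\<^sup>2 / c\<^sup>2"
      using c m M by (intro add_mono diff_mono mult_left_mono divide_right_mono power_mono) auto
    also have "\<dots> = q * (norm x)\<^sup>2"
      using c m M unfolding q_def c_def by (simp add: field_simps power2_eq_square)
    finally show ?thesis .
  qed
  have q: "q < 1" using c m by (simp add: q_def)
  have "0 \<le> q"
  proof -
    \<comment> \<open>On a unit vector, \<open>bd\<close> bounds a square by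
      \<open>q\<close>.\<close>
    obtain b :: 'a where "b \<in> Basis" using nonempty_Basis by blast
    then show ?thesis using order_trans[OF zero_le_power2 bd[of b]] by simp
  qed
  then have "norm X \<le> sqrt q"
    by (intro norm_blinfun_bound) (auto intro!: power2_le_imp_le[OF order_trans[OF bd]] simp: power_mult_distrib)
  with q \<open>0 \<le> q\<close> have "norm X < 1"
    by (meson order_le_less_trans real_sqrt_lt_1_iff)
  moreover have "X x \<bullet> y = x \<bullet> X y" for x y by (simp add: X inner_diff sa)
  ultimately obtain Y where Y: "norm Y < 1" "\<And>x y. blinfun_apply Y x \<bullet> y = x \<bullet> Y y"
    "\<And>x. (x - Y x) - Y (x - Y x) = x - X x"
    using sqrt_one_minus_blinfun by blast
  \<comment> \<open>The factor \<open>sqrt c\<close> undoes the scaling: squaring gives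
    \<open>c\<close> times the identity minus \<open>X\<close>, which is \<open>f\<close>.\<close>
  define g where "g x = sqrt c *\<^sub>R (x - Y x)" for x
  show ?thesis
  proof (rule that)
    show "linear g"
      by (rule linearI) (simp_all add: g_def blinfun.bilinear_simps algebra_simps)
    show "g x \<bullet> y = x \<bullet> g y" for x y by (simp add: g_def inner_diff Y(2))
    show "0 < x \<bullet> g x" if "x \<noteq> 0" for x
    proof -
      \<comment> \<open>Since \<open>norm Y < 1\<close>, Cauchy-Schwarz makes
        \<open>x \<bullet> Y x\<close> smaller than \<open>x \<bullet> x\<close>.\<close>
      have "x \<bullet> Y x \<le> norm x * norm (Y x)" by (rule norm_cauchy_schwarz)
      also have "\<dots> \<le> norm x * (norm Y * norm x)" by (intro mult_left_mono norm_blinfun) auto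
      also have "\<dots> < norm x * (1 * norm x)" using that Y(1) by simp
      also have "\<dots> = x \<bullet> x" by (simp add: dot_square_norm power2_eq_square)
      finally show ?thesis using c by (simp add: g_def inner_diff)
    qed
    show "g (g x) = f x" for x
    proof -
      have "g (g x) = (sqrt c * sqrt c) *\<^sub>R ((x - Y x) - Y (x - Y x))"
        unfolding g_def by (simp only: blinfun.bilinear_simps scaleR_diff_right scaleR_scaleR)
      also have "\<dots> = f x" using c by (simp add: Y(3) X)
      finally show ?thesis .
    qed
  qed
qed

section \<open>Inverses, transposes and differences of matrices\<close>

lemma matrix_mul_inv:
  assumes "invertible A"
  shows "A ** matrix_inv A = mat 1"
  using assms unfolding invertible_def matrix_inv_def by (metis (mono_tags, lifting) someI_ex)

lemma matrix_inv_mul: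
  assumes "invertible A"
  shows "matrix_inv A ** A = mat 1"
  using assms unfolding invertible_def matrix_inv_def by (metis (mono_tags, lifting) someI_ex)

lemma invertible_matrix_inv: "invertible A \<Longrightarrow> invertible (matrix_inv A)"
  using matrix_mul_inv matrix_inv_mul unfolding invertible_def by blast

lemma trace_transpose: "trace (transpose A) = trace A"
  by (simp add: trace_def transpose_def)

lemma transpose_diff: "transpose (A - B) = transpose A - transpose B"
  by (simp add: transpose_def vec_eq_iff)

lemma matrix_diff_left:
  fixes A B :: "'a::ring_1^'n^'m" and C :: "'a^'p^'n"
  shows "(A - B) ** C = A ** C - B ** C"
  by (simp add: matrix_matrix_mult_def vec_eq_iff left_diff_distrib sum_subtractf)

lemma matrix_diff_right:
  fixes A :: "'a::ring_1^'n^'m" and B C :: "'a^'p^'n"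
  shows "A ** (B - C) = A ** B - A ** C"
  by (simp add: matrix_matrix_mult_def vec_eq_iff right_diff_distrib sum_subtractf)

section \<open>Symmetric positive definite matrices\<close>

lemma SPD_symmetric: "S \<in> SPD \<Longrightarrow> transpose S = S"
  by (simp add: SPD_def)

lemma SPD_sqrt:
  fixes S :: "real^'n^'n"
  assumes "S \<in> SPD"
  obtains K where "K \<in> SPD" "K ** K = S"
proof -
  have "(S *v x) \<bullet> y = x \<bullet> (S *v y)" for x y
    using SPD_symmetric[OF assms] by (metis dot_lmul_matrix vector_transpose_matrix)
  then obtain g where g: "linear g" "\<And>x y. g x \<bullet> y = x \<bullet> g y"
    "\<And>x. x \<noteq> 0 \<Longrightarrow> 0 < x \<bullet> g x" "\<And>x. g (g x) = S *v x"
    using posdef_selfadjoint_sqrt[of "(*v) S"] assms by (auto simp: SPD_def)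
  have *: "matrix g *v x = g x" for x using g(1) by (simp add: matrix_works)
  \<comment> \<open>Entries are inner products with axis vectors, to which self-adjointness of
    \<open>g\<close> applies.\<close>
  have "transpose (matrix g) = matrix g"
    by (simp add: vec_eq_iff transpose_def matrix_def)
      (metis g(2) cart_eq_inner_axis inner_commute)
  then have "matrix g \<in> SPD" using g(3) by (simp add: SPD_def *)
  moreover have "matrix g ** matrix g = S"
    by (simp add: matrix_eq matrix_vector_mul_assoc[symmetric] * g(4))
  ultimately show ?thesis using that by blast
qed

text \<open>The quadratic form vanishes at a kernel vector, so the kernel is trivial.\<close>

lemma SPD_invertible: "S \<in> SPD \<Longrightarrow> invertible S"
  unfolding invertible_left_inverse matrix_left_invertible_ker SPD_def
  by (metis (mono_tags, lifting) inner_zero_right less_irrefl mem_Collect_eq)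

text \<open>The form at \<open>x\<close> is that of \<open>S\<close> at
  \<open>transpose C *v x\<close>, which is nonzero for nonzero \<open>x\<close> because the
  transpose is invertible too.\<close>

lemma SPD_congruence:
  fixes C S :: "real^'n^'n"
  assumes "S \<in> SPD" "invertible C"
  shows "C ** S ** transpose C \<in> SPD"
proof -
  have "transpose C *v x \<noteq> 0" if "x \<noteq> 0" for x
    using assms(2) that transpose_invertible invertible_left_inverse matrix_left_invertible_ker by metis
  moreover have "x \<bullet> ((C ** S ** transpose C) *v x) = (transpose C *v x) \<bullet> (S *v (transpose C *v x))" for x
    by (metis dot_lmul_matrix matrix_vector_mul_assoc matrix_mul_assoc transpose_matrix_vector)
  ultimately show ?thesis
    using assms(1) by (simp add: SPD_def matrix_transpose_mul matrix_mul_assoc)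
qed

section \<open>Positivity of traces\<close>

lemma trace_mult_transpose:
  fixes M :: "real^'n^'m"
  shows "trace (M ** transpose M) = (\<Sum>i\<in>UNIV. \<Sum>j\<in>UNIV. (M $ i $ j)\<^sup>2)"
  by (simp add: trace_def matrix_matrix_mult_def transpose_def power2_eq_square)

text \<open>The trace is the squared Frobenius norm of \<open>M\<close>.\<close>

lemma trace_mult_transpose_pos:
  fixes M :: "real^'n^'m"
  assumes "M \<noteq> 0"
  shows "0 < trace (M ** transpose M)"
proof -
  have "trace (M ** transpose M) \<noteq> 0"
    using assms by (simp add: trace_mult_transpose sum_nonneg_eq_0_iff sum_nonneg vec_eq_iff)
  moreover have "0 \<le> trace (M ** transpose M)"
    by (simp add: trace_mult_transpose sum_nonneg)
  ultimately show ?thesis by linarith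
qed

text \<open>With square roots \<open>R\<close> of \<open>P\<close> and \<open>K\<close> of
  \<open>S\<close>, cyclicity of the trace produces the squared Frobenius norm of
  \<open>R ** N ** K\<close>.\<close>

lemma trace_SPD_congruence_pos:
  fixes P S N :: "real^'n^'n"
  assumes "P \<in> SPD" "S \<in> SPD" "N \<noteq> 0"
  shows "0 < trace (P ** (N ** S ** transpose N))"
proof -
  obtain R where R: "R \<in> SPD" "R ** R = P" using SPD_sqrt[OF assms(1)] .
  obtain K where K: "K \<in> SPD" "K ** K = S" using SPD_sqrt[OF assms(2)] .
  have "R ** N ** K \<noteq> 0"
  proof
    assume 0: "R ** N ** K = 0"
    have "N = matrix_inv R ** R ** N ** (K ** matrix_inv K)"
      using R(1) K(1) by (simp add: SPD_invertible matrix_mul_inv matrix_inv_mul)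
    also have "\<dots> = matrix_inv R ** (R ** N ** K) ** matrix_inv K"
      by (simp add: matrix_mul_assoc)
    finally show False using 0 assms(3) by simp
  qed
  moreover have "trace (P ** (N ** S ** transpose N)) = trace (R ** (R ** N ** K ** K ** transpose N))"
    by (simp add: R(2)[symmetric] K(2)[symmetric] matrix_mul_assoc)
  moreover have "\<dots> = trace ((R ** N ** K) ** transpose (R ** N ** K))"
    by (subst trace_mul_sym)
      (simp add: matrix_transpose_mul matrix_mul_assoc SPD_symmetric R(1) K(1))
  ultimately show ?thesis using trace_mult_transpose_pos by metis
qed

section \<open>Feasible matrices and strict minimality\<close>

text \<open>Used twice: it supplies the second factor of \<open>A\<close>, and it writes every
  feasible competitor as \<open>P\<close> times a group element.\<close>

lemma O_group_left_factor:
  fixes P B S :: "real^'n^'n"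
  assumes "P \<in> SPD" "B \<in> GL" "B ** S ** transpose B = P ** S ** P"
  shows "matrix_inv P ** B \<in> O_group S"
proof -
  have P: "invertible P" "transpose P = P"
    using assms(1) by (simp_all add: SPD_invertible SPD_symmetric)
  have tP: "P ** transpose (matrix_inv P) = mat 1"
    using P by (metis matrix_inv_mul matrix_transpose_mul transpose_mat)
  have "(matrix_inv P ** B) ** S ** transpose (matrix_inv P ** B)
      = matrix_inv P ** (B ** S ** transpose B) ** transpose (matrix_inv P)"
    by (simp add: matrix_transpose_mul matrix_mul_assoc)
  also have "\<dots> = (matrix_inv P ** P) ** S ** (P ** transpose (matrix_inv P))"
    by (simp add: assms(3) matrix_mul_assoc)
  also have "\<dots> = S" using P by (simp add: tP matrix_inv_mul)
  finally have "(matrix_inv P ** B) ** S ** transpose (matrix_inv P ** B) = S" .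
  moreover have "invertible (matrix_inv P ** B)"
    using P assms(2) by (simp add: GL_def invertible_mult invertible_matrix_inv)
  ultimately show ?thesis by (simp add: O_group_def GL_def)
qed

text \<open>Symmetry of \<open>S\<close> merges the two cross terms. The last term is constant on
  feasible \<open>B\<close>, so lowering \<open>J\<close> means raising
  \<open>trace (B ** S)\<close>.\<close>

lemma J_expand:
  fixes S B :: "real^'n^'n"
  assumes "transpose S = S"
  shows "J S B = trace S - 2 * trace (B ** S) + trace (B ** S ** transpose B)"
proof -
  have "trace (S ** transpose B) = trace (B ** S)"
    by (metis assms matrix_transpose_mul trace_transpose)
  then show ?thesis
    by (simp add: J_def transpose_diff matrix_diff_left matrix_diff_right trace_sub)
qed

lemma J_strict_min:
  fixes P S B :: "real^'n^'n"
  assumes P: "P \<in> SPD" and S: "S \<in> SPD" and B: "B \<in> GL"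
    and eq: "B ** S ** transpose B = P ** S ** P" and ne: "B \<noteq> P"
  shows "J S P < J S B"
proof -
  define Q where "Q = matrix_inv P ** B"
  have BQ: "B = P ** Q"
    using P by (simp add: Q_def matrix_mul_assoc SPD_invertible matrix_mul_inv)
  have Q: "Q ** S ** transpose Q = S"
    using O_group_left_factor[OF P B eq] by (simp add: O_group_def Q_def)
  have "mat 1 - Q \<noteq> 0" using ne BQ by auto
  then have "0 < trace (P ** ((mat 1 - Q) ** S ** transpose (mat 1 - Q)))"
    using trace_SPD_congruence_pos P S by blast
  \<comment> \<open>The quadratic term in \<open>Q\<close> collapses to \<open>S\<close>, leaving
    only terms of degree at most one.\<close>
  also have "(mat 1 - Q) ** S ** transpose (mat 1 - Q) = (S - Q ** S) - (S ** transpose Q - S)"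
    by (simp add: transpose_diff matrix_diff_left matrix_diff_right Q)
  also have "trace (P ** \<dots>) = 2 * trace (P ** S) - trace (P ** Q ** S) - trace (P ** (S ** transpose Q))"
    by (simp only: matrix_diff_right trace_sub matrix_mul_assoc)
  also have "trace (P ** (S ** transpose Q)) = trace (P ** Q ** S)"
  proof -
    have "trace (P ** (S ** transpose Q)) = trace (transpose (P ** (S ** transpose Q)))"
      by (simp only: trace_transpose)
    also have "\<dots> = trace (Q ** S ** P)"
      by (simp add: matrix_transpose_mul SPD_symmetric[OF P] SPD_symmetric[OF S])
    also have "\<dots> = trace (P ** Q ** S)"
      by (subst trace_mul_sym) (simp add: matrix_mul_assoc)
    finally show ?thesis .
  qed
  \<comment> \<open>The positive quantity is twice \<open>trace (P ** S) - trace (B ** S)\<close>,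
    which equals \<open>J S B - J S P\<close>.\<close>
  finally have "trace (B ** S) < trace (P ** S)" by (simp add: BQ)
  then show ?thesis
    by (simp add: J_expand SPD_symmetric[OF S] SPD_symmetric[OF P] eq)
qed

section \<open>The quadratic matrix equation\<close>

text \<open>Multiplying by \<open>K\<close> on both sides makes \<open>K ** P ** K\<close> a square
  root of \<open>K ** T ** K\<close>. The resulting \<open>P\<close> is the geometric mean of
  \<open>T\<close> and the inverse of \<open>S\<close>.\<close>

lemma SPD_quadratic_solution:
  fixes S T :: "real^'n^'n"
  assumes S: "S \<in> SPD" and T: "T \<in> SPD"
  obtains P where "P \<in> SPD" "P ** S ** P = T"
proof -
  obtain K where K: "K \<in> SPD" "K ** K = S" using SPD_sqrt[OF S] .
  have tK: "transpose K = K" and iK: "invertible K"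
    using K(1) by (simp_all add: SPD_symmetric SPD_invertible)
  define L where "L = matrix_inv K"
  have LK: "L ** K = mat 1" "K ** L = mat 1" using iK by (simp_all add: L_def matrix_mul_inv matrix_inv_mul)
  have iL: "invertible L" using iK by (simp add: L_def invertible_matrix_inv)
  \<comment> \<open>Transposing \<open>L ** K = mat 1\<close> shows that \<open>transpose L\<close>
    also inverts \<open>K\<close>.\<close>
  have tL: "transpose L = L"
    using LK tK by (metis matrix_mul_assoc matrix_mul_lid matrix_mul_rid matrix_transpose_mul transpose_mat)
  have "K ** T ** K \<in> SPD" using SPD_congruence[OF T iK] by (simp add: tK)
  then obtain R where R: "R \<in> SPD" "R ** R = K ** T ** K" using SPD_sqrt by blast
  have "(L ** R ** L) ** S ** (L ** R ** L) = L ** R ** (L ** K) ** (K ** L) ** R ** L"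
    by (simp add: K(2)[symmetric] matrix_mul_assoc)
  also have "\<dots> = L ** (R ** R) ** L" by (simp add: LK matrix_mul_assoc)
  also have "\<dots> = (L ** K) ** T ** (K ** L)" by (simp add: R(2) matrix_mul_assoc)
  also have "\<dots> = T" by (simp add: LK)
  finally have "(L ** R ** L) ** S ** (L ** R ** L) = T" .
  moreover have "L ** R ** L \<in> SPD" using SPD_congruence[OF R(1) iL] by (simp add: tL)
  ultimately show ?thesis using that by blast
qed

theorem theorem2p7:
  fixes A \<Sigma>\<^sub>0 \<Sigma>\<^sub>1 :: "real^'n^'n"
  assumes "A \<in> GL"
    and "\<Sigma>\<^sub>0 \<in> SPD"
    and "\<Sigma>\<^sub>1 = A ** \<Sigma>\<^sub>0 ** transpose A"
  shows "(\<exists>!PQ. PQ \<in> SPD \<times> O_group \<Sigma>\<^sub>0 \<and> A = fst PQ ** snd PQ) \<and>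
         (\<forall>P \<in> SPD. \<forall>Q \<in> O_group \<Sigma>\<^sub>0. A = P ** Q \<longrightarrow>
           (\<forall>B. is_arg_min (J \<Sigma>\<^sub>0) (\<lambda>B. B \<in> GL \<and> B ** \<Sigma>\<^sub>0 ** transpose B = \<Sigma>\<^sub>1) B
                \<longleftrightarrow> B = P))"
proof -
  \<comment> \<open>The factor \<open>Q\<close> drops out because it preserves
    \<open>\<Sigma>\<^sub>0\<close>.\<close>
  have feasible: "P ** \<Sigma>\<^sub>0 ** P = \<Sigma>\<^sub>1" if "P \<in> SPD" "Q \<in> O_group \<Sigma>\<^sub>0" "A = P ** Q" for P Q
  proof -
    have "\<Sigma>\<^sub>1 = P ** (Q ** \<Sigma>\<^sub>0 ** transpose Q) ** transpose P"
      by (simp add: assms(3) that(3) matrix_transpose_mul matrix_mul_assoc)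
    then show ?thesis using that by (simp add: O_group_def SPD_symmetric)
  qed
  have inGL: "P \<in> GL" if "P \<in> SPD" for P :: "real^'n^'n"
    using that by (simp add: GL_def SPD_invertible)
  have "\<Sigma>\<^sub>1 \<in> SPD" using SPD_congruence assms by (auto simp: GL_def)
  then obtain P where P: "P \<in> SPD" "P ** \<Sigma>\<^sub>0 ** P = \<Sigma>\<^sub>1"
    using SPD_quadratic_solution assms(2) by blast
  have Q: "matrix_inv P ** A \<in> O_group \<Sigma>\<^sub>0"
    using O_group_left_factor P assms by metis
  have A: "A = P ** (matrix_inv P ** A)"
    using P(1) by (simp add: matrix_mul_assoc SPD_invertible matrix_mul_inv matrix_inv_mul)
  have uniq: "P' = P \<and> Q' = matrix_inv P ** A"
    if "P' \<in> SPD" "Q' \<in> O_group \<Sigma>\<^sub>0" "A = P' ** Q'" for P' Q'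
  proof -
    have P': "P' ** \<Sigma>\<^sub>0 ** P' = \<Sigma>\<^sub>1" using feasible that by blast
    have "P' = P"
    proof (rule ccontr)
      assume "P' \<noteq> P"
      \<comment> \<open>Both matrices are feasible, so strict minimality would put each strictly
        below the other.\<close>
      then have "J \<Sigma>\<^sub>0 P < J \<Sigma>\<^sub>0 P'" "J \<Sigma>\<^sub>0 P' < J \<Sigma>\<^sub>0 P"
        using P P' that(1) assms(2) by (auto intro!: J_strict_min inGL simp: SPD_symmetric)
      then show False by simp
    qed
    \<comment> \<open>Cancelling the invertible \<open>P\<close> then determines the second
      factor.\<close>
    then show ?thesis
      using P(1) that(3) by (simp add: matrix_mul_assoc SPD_invertible matrix_mul_inv matrix_inv_mul)
  qed
  have "\<exists>!PQ. PQ \<in> SPD \<times> O_group \<Sigma>\<^sub>0 \<and> A = fst PQ ** snd PQ"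
  proof (rule ex1I)
    show "(P, matrix_inv P ** A) \<in> SPD \<times> O_group \<Sigma>\<^sub>0
        \<and> A = fst (P, matrix_inv P ** A) ** snd (P, matrix_inv P ** A)"
      using P(1) Q A by (simp only: mem_Times_iff fst_conv snd_conv simp_thms)
    show "PQ = (P, matrix_inv P ** A)"
      if "PQ \<in> SPD \<times> O_group \<Sigma>\<^sub>0 \<and> A = fst PQ ** snd PQ" for PQ
      using uniq[of "fst PQ" "snd PQ"] that unfolding mem_Times_iff prod_eq_iff fst_conv snd_conv by blast
  qed
  moreover have "is_arg_min (J \<Sigma>\<^sub>0) (\<lambda>B. B \<in> GL \<and> B ** \<Sigma>\<^sub>0 ** transpose B = \<Sigma>\<^sub>1) B \<longleftrightarrow> B = P'"
    if "P' \<in> SPD" "Q' \<in> O_group \<Sigma>\<^sub>0" "A = P' ** Q'" for P' Q' B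
  proof -
    have P': "P' ** \<Sigma>\<^sub>0 ** P' = \<Sigma>\<^sub>1" using feasible that by blast
    \<comment> \<open>Strictness gives both directions: \<open>P'\<close> is a minimizer, and any
      other feasible matrix is beaten by it.\<close>
    have "J \<Sigma>\<^sub>0 P' < J \<Sigma>\<^sub>0 C" if "C \<in> GL" "C ** \<Sigma>\<^sub>0 ** transpose C = \<Sigma>\<^sub>1" "C \<noteq> P'" for C
      using J_strict_min \<open>P' \<in> SPD\<close> assms(2) that P' by metis
    moreover have "P' \<in> GL \<and> P' ** \<Sigma>\<^sub>0 ** transpose P' = \<Sigma>\<^sub>1"
      using P' that(1) by (simp add: inGL SPD_symmetric)
    ultimately show ?thesis
      unfolding is_arg_min_def by (metis less_asym less_irrefl)
  qed
  ultimately show ?thesis by blast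
qed

end
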